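(* For every real $R>3/2$ and every $\epsilon>0$, the competitive ratio of the proportional\&non-removable online knapsack problem with a buffer of capacity $R$ is at least $2-\epsilon$.
   Context: Online knapsack problem with a resource buffer: there is a knapsack of capacity $1$ and a buffer of capacity $R\ge 1$. Items $e_1,\dots,e_n$ arrive one by one; each item $e$ has size $0<s(e)\le 1$ and value $v(e)\ge 0$; $s(B),v(B)$ denote sums over a set $B$. A deterministic online algorithm maintains buffer contents $B_0=\emptyset,B_1,\dots,B_n$, with $B_i$ chosen after seeing only $e_1,\dots,e_i$, $B_i\subseteq B_{i-1}\cup\{e_i\}$, $s(B_i)\le R$; in the non-removable setting additionally $B_{i-1}\subseteq B_i$. $\mathrm{ALG}(I)=\max\{v(B)\mid B\subseteq B_n,\ s(B)\le 1\}$, $\mathrm{OPT}(I)=\max\{v(B)\mid B\subseteq\{e_1,\dots,e_n\},\ s(B)\le 1\}$. "Proportional" means $v(e)=s(e)$ for every item. The competitive ratio of an algorithm is $\sup_I \mathrm{OPT}(I)/\mathrm{ALG}(I)$ (with $a/0=\infty$ for $a>0$), and the competitive ratio of the problem is the infimum of this over all deterministic online algorithms. *)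

theory Defs
  imports Complex_Main "HOL-Library.Extended_Real"
begin

datatype item = Item (item_size: real) (item_value: real)

text \<open>
  An instance is the list of items in order of arrival. Sets of items are represented by sets of
  positions in this list, so that two items of equal size and value remain distinct. Position
  \<open>i\<close> is the item written $e_{i+1}$ when counting from one.
\<close>

definition instances :: "item list set" where
  "instances = {I. \<forall>e\<in>set I. 0 < item_size e \<and> item_size e \<le> 1 \<and> 0 \<le> item_value e}"

definition proportional_instances :: "item list set" where
  "proportional_instances = {I \<in> instances. \<forall>e\<in>set I. item_value e = item_size e}"

definition total_size :: "item list \<Rightarrow> nat set \<Rightarrow> real" where
  "total_size I B = (\<Sum>i\<in>B. item_size (I ! i))"

definition total_value :: "item list \<Rightarrow> nat set \<Rightarrow> real" where
  "total_value I B = (\<Sum>i\<in>B. item_value (I ! i))"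

definition best_packing :: "item list \<Rightarrow> nat set \<Rightarrow> real" where
  "best_packing I S = Max {total_value I B | B. B \<subseteq> S \<and> total_size I B \<le> 1}"

definition OPT :: "item list \<Rightarrow> real" where
  "OPT I = best_packing I {..<length I}"

text \<open>
  A deterministic online algorithm maps the list of items seen so far to the current buffer;
  on an instance \<open>I\<close> the buffer $B_i$ is \<open>A (take i I)\<close>.
\<close>

type_synonym algorithm = "item list \<Rightarrow> nat set"

definition ALG :: "algorithm \<Rightarrow> item list \<Rightarrow> real" where
  "ALG A I = best_packing I (A I)"

text \<open>
  Feasibility is only required on the instances \<open>\<I>\<close> of the problem under consideration.
\<close>

definition online_algorithms :: "real \<Rightarrow> item list set \<Rightarrow> algorithm set" where
  "online_algorithms R \<I> = {A. \<forall>I\<in>\<I>. A [] = {} \<and>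
     (\<forall>i<length I. A (take (Suc i) I) \<subseteq> A (take i I) \<union> {i} \<and>
                   total_size I (A (take (Suc i) I)) \<le> R)}"

definition nonremovable_algorithms :: "real \<Rightarrow> item list set \<Rightarrow> algorithm set" where
  "nonremovable_algorithms R \<I> = {A \<in> online_algorithms R \<I>.
     \<forall>I\<in>\<I>. \<forall>i<length I. A (take i I) \<subseteq> A (take (Suc i) I)}"

text \<open>
  In \<^typ>\<open>ereal\<close>, \<open>a / 0 = \<infinity>\<close> for \<open>a > 0\<close>. Moreover \<open>0 / 0 = 0\<close>, so instances with
  optimum zero do not contribute to the supremum.
\<close>

definition algorithm_ratio :: "item list set \<Rightarrow> algorithm \<Rightarrow> ereal" where
  "algorithm_ratio \<I> A = (SUP I\<in>\<I>. ereal (OPT I) / ereal (ALG A I))"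

definition competitive_ratio :: "item list set \<Rightarrow> algorithm set \<Rightarrow> ereal" where
  "competitive_ratio \<I> \<A> = (INF A\<in>\<A>. algorithm_ratio \<I> A)"

lemma ratio_zero_denominator:
  "a > 0 \<Longrightarrow> ereal a / ereal 0 = \<infinity>" "ereal 0 / ereal 0 = 0"
  by (simp_all add: divide_ereal_def flip: zero_ereal_def)

end

theory Submission
  imports Defs
begin

text \<open>
  The adversary sends items of strictly decreasing sizes slightly above $1/2$. A non-removable
  buffer of bounded capacity must refuse one of them, say of size $x$, and the adversary then sends
  a last item of size $1 - x$. The optimum is $1$, whereas any two items in the buffer have total
  size greater than $1$: every accepted earlier item is larger than $x$. So the algorithm is left
  with a single item of size close to $1/2$.
\<close>

lemma finite_packings:
  "finite S \<Longrightarrow> finite {total_value I B | B. B \<subseteq> S \<and> total_size I B \<le> 1}"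
  by (rule finite_surj[of "Pow S" _ "total_value I"]) auto

lemma le_best_packing:
  assumes "finite S" "B \<subseteq> S" "total_size I B \<le> 1"
  shows "total_value I B \<le> best_packing I S"
  unfolding best_packing_def using finite_packings[OF assms(1)] assms(2,3) by (intro Max_ge) auto

lemma best_packing_nonneg: "finite S \<Longrightarrow> 0 \<le> best_packing I S"
  using le_best_packing[of S "{}" I] by (simp add: total_size_def total_value_def)

lemma best_packing_leI:
  assumes "finite S" "\<And>B. B \<subseteq> S \<Longrightarrow> total_size I B \<le> 1 \<Longrightarrow> total_value I B \<le> c"
  shows "best_packing I S \<le> c"
proof -
  \<comment> \<open>The empty packing makes the set under \<open>Max\<close> nonempty, as
    \<open>Max_le_iff\<close> requires.\<close>
  have "total_value I {} \<in> {total_value I B | B. B \<subseteq> S \<and> total_size I B \<le> 1}"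
    by (auto simp: total_size_def intro!: exI[of _ "{}"])
  then show ?thesis
    unfolding best_packing_def using finite_packings[OF assms(1)] assms(2)
    by (subst Max_le_iff) auto
qed

text \<open>Two items in one packing would already overfill the knapsack, because the remaining
  sizes are nonnegative. So every packing is empty or a single item; \<open>0 \<le> c\<close> covers
  the empty one.\<close>

lemma best_packing_le_of_pairwise_conflict:
  assumes "finite S" "0 \<le> c"
    and nonneg: "\<And>i. i \<in> S \<Longrightarrow> 0 \<le> item_size (I ! i)"
    and le: "\<And>i. i \<in> S \<Longrightarrow> item_value (I ! i) \<le> c"
    and conflict: "\<And>i j. i \<in> S \<Longrightarrow> j \<in> S \<Longrightarrow> i < j \<Longrightarrow> 1 < item_size (I ! i) + item_size (I ! j)"
  shows "best_packing I S \<le> c"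
proof (rule best_packing_leI[OF \<open>finite S\<close>])
  fix B assume B: "B \<subseteq> S" "total_size I B \<le> 1"
  have eq: "i = j" if ij: "i \<in> B" "j \<in> B" for i j
  proof (rule ccontr)
    assume "i \<noteq> j"
    then have "1 < item_size (I ! i) + item_size (I ! j)"
      using conflict[of i j] conflict[of j i] ij B(1) by (cases i j rule: linorder_cases) (auto simp: add.commute)
    also have "\<dots> = total_size I {i, j}"
      using \<open>i \<noteq> j\<close> by (simp add: total_size_def)
    also have "\<dots> \<le> total_size I B"
      unfolding total_size_def using ij B(1) nonneg \<open>finite S\<close>
      by (intro sum_mono2) (auto intro: finite_subset)
    finally show False using B(2) by simp
  qed
  show "total_value I B \<le> c"
  proof (cases "B = {}")
    case False
    then obtain i where "i \<in> B" by blast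
    with eq have "B = {i}" by blast
    then show ?thesis using le[of i] B(1) by (simp add: total_value_def)
  qed (simp add: total_value_def \<open>0 \<le> c\<close>)
qed

lemma online_algorithm_step:
  assumes "A \<in> online_algorithms R \<I>" "I \<in> \<I>" "i < length I"
  shows "A (take (Suc i) I) \<subseteq> A (take i I) \<union> {i}"
    and "total_size I (A (take (Suc i) I)) \<le> R"
  using assms by (auto simp: online_algorithms_def)

lemma online_algorithm_subset:
  assumes "A \<in> online_algorithms R \<I>" "I \<in> \<I>" "n \<le> length I"
  shows "A (take n I) \<subseteq> {..<n}"
  using assms(3)
proof (induction n)
  case 0
  then show ?case using assms(1,2) by (auto simp: online_algorithms_def)
next
  case (Suc n)
  then have "A (take (Suc n) I) \<subseteq> A (take n I) \<union> {n}"
    using online_algorithm_step(1)[OF assms(1,2)] by simp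
  with Suc show ?case by fastforce
qed

lemma nonremovable_mono:
  assumes "A \<in> nonremovable_algorithms R \<I>" "I \<in> \<I>" "m \<le> n" "n \<le> length I"
  shows "A (take m I) \<subseteq> A (take n I)"
  using assms(3,4)
proof (induction n rule: dec_induct)
  case (step n)
  then have "A (take n I) \<subseteq> A (take (Suc n) I)"
    using assms(1,2) by (auto simp: nonremovable_algorithms_def)
  with step show ?case by auto
qed auto

text \<open>If each item were accepted on arrival, none could leave later, and the final buffer
  would hold all of \<open>I\<close>, exceeding the capacity.\<close>

lemma nonremovable_rejects:
  assumes A: "A \<in> nonremovable_algorithms R \<I>" and I: "I \<in> \<I>" "I \<noteq> []"
    and large: "R < total_size I {..<length I}"
  shows "\<exists>k<length I. k \<notin> A (take (Suc k) I)"
proof (rule ccontr)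
  assume "\<not> ?thesis"
  then have "k \<in> A I" if "k < length I" for k
    using nonremovable_mono[OF A I(1), of "Suc k" "length I"] that by auto
  then have "{..<length I} \<subseteq> A I" by blast
  moreover have on: "A \<in> online_algorithms R \<I>"
    using A by (simp add: nonremovable_algorithms_def)
  moreover have "A I \<subseteq> {..<length I}"
    using online_algorithm_subset[OF on I(1), of "length I"] by simp
  moreover have "total_size I (A I) \<le> R"
  proof -
    \<comment> \<open>The capacity bound is available only after an arrival, hence the need for a
      last item.\<close>
    from I(2) obtain m where m: "length I = Suc m" by (cases I) auto
    then have "total_size I (A (take (Suc m) I)) \<le> R"
      using online_algorithm_step(2)[OF on I(1), of m] by simp
    then show ?thesis using m by simp
  qed
  ultimately show False using large by (metis not_le subset_antisym)
qed

definition proportional_item :: "real \<Rightarrow> item" where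
  "proportional_item x = Item x x"

lemma proportional_item_sel [simp]:
  "item_size (proportional_item x) = x" "item_value (proportional_item x) = x"
  by (simp_all add: proportional_item_def)

lemma map_proportional_item_in_instances:
  "(\<And>x. x \<in> set xs \<Longrightarrow> 0 < x \<and> x \<le> 1) \<Longrightarrow>
    map proportional_item xs \<in> proportional_instances"
  by (auto simp: proportional_instances_def instances_def less_imp_le)

text \<open>The accuracy \<open>d\<close> is independent of \<open>R\<close>: a larger buffer only
  lengthens the sequence needed to force a rejection. The bound \<open>0 \<le> ALG A I\<close>
  excludes a negative denominator in the ratio.\<close>

lemma nonremovable_hard_instance:
  assumes A: "A \<in> nonremovable_algorithms R proportional_instances"
    and d: "0 < d" "d < 1 / 2"
  shows "\<exists>I\<in>proportional_instances. 1 \<le> OPT I \<and> 0 \<le> ALG A I \<and> ALG A I \<le> 1 / 2 + d"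
proof -
  define x where "x i = 1 / 2 + d / real (Suc i)" for i
  have x_gt: "1 / 2 < x i" and x_le: "x i \<le> 1 / 2 + d" for i
    using d by (simp_all add: x_def divide_le_eq mult_le_cancel_left1)
  have x_less_1: "x i < 1" for i
    using x_le[of i] d(2) by simp
  have x_decr: "x j < x i" if "i < j" for i j
    using that d by (simp add: x_def frac_less2)
  have x_pos: "0 < x i" for i
    using x_gt[of i] by simp
  define J where "J n = map proportional_item (map x [0..<n])" for n
  have J: "J n \<in> proportional_instances" for n
    unfolding J_def
    by (rule map_proportional_item_in_instances) (auto simp: x_pos less_imp_le[OF x_less_1])
  \<comment> \<open>Each item exceeds 1/2, so \<open>N\<close> of them overflow the buffer. The
    absolute value forces \<open>N > 0\<close> whatever the sign of \<open>R\<close>.\<close>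
  obtain N where N: "2 * \<bar>R\<bar> < real N"
    using reals_Archimedean2 by blast
  then have "N > 0" by (cases N) auto
  have "R < (\<Sum>i<N. 1 / 2)" using N by simp
  also have "\<dots> \<le> (\<Sum>i<N. x i)"
    by (rule sum_mono) (rule less_imp_le[OF x_gt])
  also have "\<dots> = total_size (J N) {..<length (J N)}"
    by (simp add: total_size_def J_def)
  finally have "\<exists>k<length (J N). k \<notin> A (take (Suc k) (J N))"
    using \<open>N > 0\<close> by (intro nonremovable_rejects[OF A J]) (auto simp: J_def)
  \<comment> \<open>The rejection of \<open>k\<close> depends only on the prefix
    \<open>J (Suc k)\<close>, so it persists when the input continues differently.\<close>
  moreover have "take (Suc k) (J N) = J (Suc k)" if "k < N" for k
    using that by (simp add: J_def take_map del: upt_Suc)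
  ultimately obtain k where k: "k \<notin> A (J (Suc k))"
    by (auto simp: J_def simp del: upt_Suc)
  \<comment> \<open>The last item fills the knapsack exactly together with the rejected item
    \<open>k\<close>.\<close>
  define I where "I = J (Suc k) @ [proportional_item (1 - x k)]"
  have "I = map proportional_item (map x [0..<Suc k] @ [1 - x k])"
    by (simp add: I_def J_def)
  then have I: "I \<in> proportional_instances"
    by (auto intro!: map_proportional_item_in_instances
        simp: x_pos x_less_1 less_imp_le simp del: map_append)
  have len: "length I = Suc (Suc k)" and take_I: "take (Suc k) I = J (Suc k)"
    by (simp_all add: I_def J_def)
  have nth_I: "I ! i = proportional_item (if i \<le> k then x i else 1 - x k)" if "i \<le> Suc k" for i
    using that by (auto simp: I_def J_def nth_append simp del: upt_Suc)
  have on: "A \<in> online_algorithms R proportional_instances"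
    using A by (simp add: nonremovable_algorithms_def)
  have AI: "A I \<subseteq> {..Suc k}"
    using online_algorithm_subset[OF on I, of "length I"] len by auto
  then have fin: "finite (A I)" by (rule finite_subset) simp
  \<comment> \<open>The last step can add only position \<open>Suc k\<close>, so the rejected
    \<open>k\<close> cannot return.\<close>
  have "A (take (Suc (Suc k)) I) \<subseteq> A (take (Suc k) I) \<union> {Suc k}"
    using online_algorithm_step(1)[OF on I, of "Suc k"] len by simp
  moreover have "take (Suc (Suc k)) I = I" using len by simp
  ultimately have notin: "k \<notin> A I" using k take_I by auto
  have "1 \<le> OPT I"
  proof -
    have eq: "total_size I {k, Suc k} = 1" "total_value I {k, Suc k} = 1"
      by (simp_all add: total_size_def total_value_def nth_I)
    then show ?thesis
      using le_best_packing[of "{..<length I}" "{k, Suc k}" I] len by (simp add: OPT_def)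
  qed
  moreover have "0 \<le> ALG A I"
    unfolding ALG_def by (rule best_packing_nonneg[OF fin])
  moreover have "ALG A I \<le> 1 / 2 + d"
    unfolding ALG_def
  proof (rule best_packing_le_of_pairwise_conflict[OF fin])
    \<comment> \<open>Since \<open>k\<close> is missing, the earlier position satisfies
      \<open>i < k\<close>. If \<open>j\<close> is the last item, the sum is
      \<open>x i + 1 - x k\<close>, above 1 because \<open>x\<close> decreases; otherwise both sizes
      exceed 1/2.\<close>
    fix i j assume ij: "i \<in> A I" "j \<in> A I" "i < j"
    then have le: "i \<le> Suc k" "j \<le> Suc k" and "i < k" using AI notin by (auto simp: nat_less_le)
    then show "1 < item_size (I ! i) + item_size (I ! j)"
      using x_gt[of i] x_gt[of j] x_decr[of i k] by (simp add: nth_I)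
  next
    fix i assume "i \<in> A I"
    then have "i \<le> Suc k" using AI by auto
    then show "0 \<le> item_size (I ! i)" "item_value (I ! i) \<le> 1 / 2 + d"
      using x_pos[of i] x_le[of i] x_less_1[of k] x_gt[of k] d by (simp_all add: nth_I)
  qed (use d in simp)
  ultimately show ?thesis using I by blast
qed

theorem theorem3:
  fixes R \<epsilon> :: real
  assumes "R > 3 / 2" and "\<epsilon> > 0"
  shows "ereal (2 - \<epsilon>) \<le>
    competitive_ratio proportional_instances (nonremovable_algorithms R proportional_instances)"
  unfolding competitive_ratio_def
proof (rule INF_greatest)
  fix A assume A: "A \<in> nonremovable_algorithms R proportional_instances"
  \<comment> \<open>The choice gives \<open>2 - \<epsilon> \<le> 2 - 4 * d\<close>, and the cap 1/4
    keeps \<open>2 - 4 * d\<close> positive, which the monotonicity of the product below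
    uses.\<close>
  define d where "d = min (1 / 4) (\<epsilon> / 4)"
  have d: "0 < d" "d < 1 / 2" "4 * d \<le> \<epsilon>"
    using \<open>\<epsilon> > 0\<close> by (auto simp: d_def)
  from nonremovable_hard_instance[OF A d(1,2)] obtain I where
    I: "I \<in> proportional_instances" and opt: "1 \<le> OPT I" and
    alg: "0 \<le> ALG A I" "ALG A I \<le> 1 / 2 + d" by blast
  have "ereal (2 - \<epsilon>) \<le> ereal (OPT I) / ereal (ALG A I)"
  proof (cases "ALG A I = 0")
    \<comment> \<open>The algorithm may have accepted nothing; the quotient is then
      infinite.\<close>
    case True
    then show ?thesis using ratio_zero_denominator(1)[of "OPT I"] opt by simp
  next
    case False
    have "(2 - \<epsilon>) * ALG A I \<le> (2 - 4 * d) * (1 / 2 + d)"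
      using alg d by (intro mult_mono) auto
    \<comment> \<open>The product equals \<open>1 - 4 * d^2\<close>.\<close>
    also have "\<dots> \<le> 1"
      by (simp add: algebra_simps)
    also note opt
    finally show ?thesis using False alg(1) by (simp add: le_divide_eq)
  qed
  also have "\<dots> \<le> algorithm_ratio proportional_instances A"
    unfolding algorithm_ratio_def using I by (rule SUP_upper)
  finally show "ereal (2 - \<epsilon>) \<le> algorithm_ratio proportional_instances A" .
qed

end
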